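(* Let $q\in(0,1)$ and let $r=\min\{q,\tfrac12\}$. As the number of rounds $k$ goes to infinity, the performance ratio of the recruiting game $G_{k,q}(1,1)$ converges to $$\frac{1+2rq}{1+q}.$$
   Context: Recruiting game. For an integer $k\ge 1$, a real $q\in(0,1)$ and positive integers $x_1,x_2$, the game $G_{k,q}(x_1,x_2)$ (also written $G_k(x_1,x_2)$) is played by two players over $k$ rounds; player $i$ has initial reputation $x_i$. In each round there are two candidates, the stronger one of quality $1$ and the weaker one of quality $q$. Knowing the outcomes of all previous rounds, the players simultaneously each choose one candidate to make an offer to. If they choose different candidates, each player hires the candidate it chose. If they choose the same candidate, player 1 hires it with probability $\frac{x_1}{x_1+x_2}$ and player 2 hires it with probability $\frac{x_2}{x_1+x_2}$, where $x_1,x_2$ are the current reputations; the player who loses hires no one in that round. A player's payoff in a round is the quality of the candidate it hires ($0$ if none). Its reputation increases by $1$ if it hired the stronger candidate and is unchanged otherwise. A player's utility is its total expected payoff over the $k$ rounds. Canonical strategies. At any point the higher player is the one with larger current reputation (player 1 in case of equality) and the other is the lower player. The strategies $s_k(x_1,x_2)$ are defined by backward induction: in every round the higher player makes an offer to the stronger candidate, and the lower player chooses the candidate maximizing its own expected total utility from the current and all later rounds, given that the later rounds are played according to these strategies; if indifferent, the lower player chooses the weaker candidate. Let $u_i(s_k(x_1,x_2))$ be player $i$'s expected utility under these strategies, and $u(s_k(x_1,x_2))=u_1(s_k(x_1,x_2))+u_2(s_k(x_1,x_2))$ the expected social welfare. Performance ratio. The maximum possible social welfare is $k(1+q)$, and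 the performance ratio of $G_{k,q}(x_1,x_2)$ is $\dfrac{u(s_k(x_1,x_2))}{k(1+q)}$. *)

theory Defs
  imports "HOL-Probability.Probability"
begin

datatype player = Player1 | Player2

datatype candidate = Stronger | Weaker

fun quality :: "real \<Rightarrow> candidate \<Rightarrow> real" where
  "quality q Stronger = 1"
| "quality q Weaker = q"

type_synonym reputation = "player \<Rightarrow> nat"

type_synonym offers = "player \<Rightarrow> candidate"

text \<open>The candidate each player hires in a round; \<open>None\<close> if the player hires no one.\<close>

type_synonym hires = "player \<Rightarrow> candidate option"

definition round_outcome :: "reputation \<Rightarrow> offers \<Rightarrow> hires pmf" where
  "round_outcome x a =
     (if a Player1 \<noteq> a Player2 then return_pmf (\<lambda>i. Some (a i))
      else map_pmf
        (\<lambda>player1_wins i. if (i = Player1) = player1_wins then Some (a i) else None)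
        (bernoulli_pmf (real (x Player1) / (real (x Player1) + real (x Player2)))))"

definition payoff :: "real \<Rightarrow> hires \<Rightarrow> player \<Rightarrow> real" where
  "payoff q h i = (case h i of None \<Rightarrow> 0 | Some c \<Rightarrow> quality q c)"

definition update_reputation :: "reputation \<Rightarrow> hires \<Rightarrow> reputation" where
  "update_reputation x h = (\<lambda>i. x i + (if h i = Some Stronger then 1 else 0))"

text \<open>A (pure) strategy profile prescribes the offers of the next round from the outcomes of
  all previous rounds, listed from the first round on.\<close>

type_synonym profile = "hires list \<Rightarrow> offers"

definition play_first :: "offers \<Rightarrow> (hires \<Rightarrow> profile) \<Rightarrow> profile" where
  "play_first a \<sigma> = (\<lambda>hs. case hs of [] \<Rightarrow> a | h # hs' \<Rightarrow> \<sigma> h hs')"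

text \<open>The distribution of the sequence of outcomes of \<open>k\<close> rounds.\<close>

primrec play :: "nat \<Rightarrow> reputation \<Rightarrow> profile \<Rightarrow> hires list pmf" where
  "play 0 x \<sigma> = return_pmf []"
| "play (Suc k) x \<sigma> =
     bind_pmf (round_outcome x (\<sigma> []))
       (\<lambda>h. map_pmf (\<lambda>hs. h # hs) (play k (update_reputation x h) (\<lambda>hs. \<sigma> (h # hs))))"

definition utility :: "real \<Rightarrow> nat \<Rightarrow> reputation \<Rightarrow> profile \<Rightarrow> player \<Rightarrow> real" where
  "utility q k x \<sigma> i =
     measure_pmf.expectation (play k x \<sigma>) (\<lambda>hs. \<Sum>h\<leftarrow>hs. payoff q h i)"

definition higher :: "reputation \<Rightarrow> player" where
  "higher x = (if x Player2 \<le> x Player1 then Player1 else Player2)"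

definition lower :: "reputation \<Rightarrow> player" where
  "lower x = (if x Player2 \<le> x Player1 then Player2 else Player1)"

definition lower_offers :: "reputation \<Rightarrow> candidate \<Rightarrow> offers" where
  "lower_offers x c = (\<lambda>i. if i = higher x then Stronger else c)"

text \<open>\<open>canonical q k x\<close> is the profile $s_k(x_1,x_2)$. For \<open>k = 0\<close> no round is played and the
  value is irrelevant.\<close>

primrec canonical :: "real \<Rightarrow> nat \<Rightarrow> reputation \<Rightarrow> profile" where
  "canonical q 0 x = (\<lambda>_ _. Weaker)"
| "canonical q (Suc k) x =
     (let later = (\<lambda>h. canonical q k (update_reputation x h));
          value_of = (\<lambda>c. utility q (Suc k) x (play_first (lower_offers x c) later) (lower x));
          c = (if value_of Stronger > value_of Weaker then Stronger else Weaker)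
      in play_first (lower_offers x c) later)"

definition social_welfare :: "real \<Rightarrow> nat \<Rightarrow> reputation \<Rightarrow> profile \<Rightarrow> real" where
  "social_welfare q k x \<sigma> = utility q k x \<sigma> Player1 + utility q k x \<sigma> Player2"

definition reputations :: "nat \<Rightarrow> nat \<Rightarrow> reputation" where
  "reputations x1 x2 = (\<lambda>i. case i of Player1 \<Rightarrow> x1 | Player2 \<Rightarrow> x2)"

definition performance_ratio :: "real \<Rightarrow> nat \<Rightarrow> nat \<Rightarrow> nat \<Rightarrow> real" where
  "performance_ratio q k x1 x2 =
     social_welfare q k (reputations x1 x2) (canonical q k (reputations x1 x2))
       / (real k * (1 + q))"

end

theory Submission
  imports Defs "HOL-Real_Asymp.Real_Asymp"
begin

text \<open>
  As long as every round is contested, the reputations form Polya's urn, whose composition after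
  \<open>j\<close> steps from \<open>(1, 1)\<close> is uniform; an uncontested round drives the reputations apart. After many
  rounds the shares hardly move any more. If the share of the lower player is then clearly below
  \<open>r\<close>, contesting earns it less than the safe payoff \<open>q\<close> per round, so almost all later rounds are
  uncontested. If \<open>q < 1 / 2\<close> and its share is clearly above \<open>q\<close>, it contests almost all later
  rounds. Moreover, for \<open>q < 1 / 2\<close> a lower player that gives way once gives way forever, so with a
  long horizon it contests any fixed number of early rounds, for the chance of a share above \<open>q\<close>.
  Hence the proportion of contested rounds tends to the probability \<open>1 - 2 * r\<close> that a uniform
  variable lies between \<open>r\<close> and \<open>1 - r\<close>.
\<close>

subsection \<open>Reputations and the recursion for the utilities\<close>

definition wins :: "player \<Rightarrow> reputation \<Rightarrow> reputation" where
  "wins i x = x(i := Suc (x i))"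

fun other :: "player \<Rightarrow> player" where
  "other Player1 = Player2"
| "other Player2 = Player1"

definition rep_sum :: "reputation \<Rightarrow> nat" where
  "rep_sum x = x Player1 + x Player2"

definition share :: "player \<Rightarrow> reputation \<Rightarrow> real" where
  "share i x = real (x i) / real (rep_sum x)"

text \<open>The expectation of \<open>g\<close> after a contested round, that is, after one step of Polya's urn.\<close>

definition urn :: "(reputation \<Rightarrow> real) \<Rightarrow> reputation \<Rightarrow> real" where
  "urn g x = share Player1 x * g (wins Player1 x) + share Player2 x * g (wins Player2 x)"

definition all_pos :: "reputation \<Rightarrow> bool" where
  "all_pos x \<longleftrightarrow> (\<forall>i. 0 < x i)"

lemma other_neq [simp]: "other i \<noteq> i" "i \<noteq> other i"
  by (cases i; simp)+

lemma other_other [simp]: "other (other i) = i"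
  by (cases i) auto

lemma eq_other_iff: "j = other i \<longleftrightarrow> j \<noteq> i"
  by (cases i; cases j) auto

lemma all_player: "(\<forall>i. P i) \<longleftrightarrow> P Player1 \<and> P Player2"
  by (metis player.exhaust)

lemma rep_sum_eq: "rep_sum x = x i + x (other i)"
  by (cases i) (auto simp: rep_sum_def)

lemma rep_sum_wins [simp]: "rep_sum (wins i x) = Suc (rep_sum x)"
  by (cases i) (auto simp: rep_sum_def wins_def)

lemma wins_same [simp]: "wins i x i = Suc (x i)"
  by (simp add: wins_def)

lemma wins_other [simp]: "wins (other i) x i = x i" "wins i x (other i) = x (other i)"
  by (auto simp: wins_def)

lemma wins_commute: "wins i (wins j x) = wins j (wins i x)"
  by (auto simp: wins_def fun_eq_iff)

lemma all_pos_wins [simp]: "all_pos x \<Longrightarrow> all_pos (wins i x)"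
  by (auto simp: all_pos_def wins_def)

lemma rep_sum_pos: "all_pos x \<Longrightarrow> 0 < rep_sum x"
  by (auto simp: all_pos_def rep_sum_def)

lemma all_posD [simp]: "all_pos x \<Longrightarrow> 0 < x i"
  by (auto simp: all_pos_def)

lemma share_nonneg [simp]: "0 \<le> share i x"
  by (simp add: share_def)

lemma share_le_1 [simp]: "share i x \<le> 1"
  using rep_sum_eq[of x i] by (auto simp: share_def divide_simps)

lemma share_pos [simp]: "all_pos x \<Longrightarrow> 0 < share i x"
  by (simp add: share_def rep_sum_pos)

lemma share_other:
  assumes "all_pos x"
  shows "share (other i) x = 1 - share i x"
proof -
  have "share (other i) x + share i x = 1"
    using rep_sum_eq[of x i] rep_sum_pos[OF assms]
    by (simp add: share_def add_divide_distrib[symmetric] flip: of_nat_add)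
  then show ?thesis by simp
qed

lemma urn_eq: "urn g x = share i x * g (wins i x) + share (other i) x * g (wins (other i) x)"
  by (cases i) (auto simp: urn_def)

lemma urn_mono:
  assumes "\<And>i. g (wins i x) \<le> h (wins i x)"
  shows "urn g x \<le> urn h x"
  unfolding urn_def by (intro add_mono mult_left_mono assms share_nonneg)

lemma urn_affine:
  assumes "all_pos x"
  shows "urn (\<lambda>y. a + b * g y) x = a + b * urn g x"
  unfolding urn_eq[of _ _ Player1] share_other[OF assms] by (simp add: algebra_simps)

lemma urn_add: "urn (\<lambda>y. g y + h y) x = urn g x + urn h x"
  by (simp add: urn_def algebra_simps)

text \<open>The martingale property of Polya's urn: the mean next reputation of \<open>i\<close> is
  \<open>x i + share i x\<close>, which is \<open>share i x\<close> times the new total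
  \<open>rep_sum x + 1\<close>.\<close>

lemma urn_share:
  assumes "all_pos x"
  shows "urn (share i) x = share i x"
proof -
  have t: "0 < rep_sum x" by (rule rep_sum_pos[OF assms])
  show ?thesis
    unfolding urn_eq[of _ _ i] share_other[OF assms]
    using t by (simp add: share_def divide_simps) (simp add: algebra_simps)
qed

lemma higher_or_lower: "i = lower x \<longleftrightarrow> i = other (higher x)" "lower x = other (higher x)"
  by (auto simp: higher_def lower_def)

lemma higher_ge: "x i \<le> x (higher x)"
  by (cases i) (auto simp: higher_def)

lemma higher_wins_higher: "higher (wins (higher x) x) = higher x"
  by (auto simp: higher_def wins_def)

lemma higher_mono: "i = higher (wins (other i) x) \<Longrightarrow> i = higher (wins i x)"
  by (cases i) (auto simp: higher_def wins_def split: if_splits)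

section \<open>Utilities as expectations over the next round\<close>

lemma finite_set_pmf_round [simp]: "finite (set_pmf (round_outcome x a))"
  by (auto simp: round_outcome_def intro: finite_subset[OF subset_UNIV])

lemma finite_set_pmf_play [simp]: "finite (set_pmf (play k x \<sigma>))"
  by (induction k arbitrary: x \<sigma>) auto

lemma utility_0 [simp]: "utility q 0 x \<sigma> i = 0"
  by (simp add: utility_def)

lemma utility_Suc:
  "utility q (Suc k) x \<sigma> i =
     measure_pmf.expectation (round_outcome x (\<sigma> []))
       (\<lambda>h. payoff q h i + utility q k (update_reputation x h) (\<lambda>hs. \<sigma> (h # hs)) i)"
proof -
  have *: "measure_pmf.expectation (play k y \<tau>) (\<lambda>hs. c + (\<Sum>h\<leftarrow>hs. payoff q h i)) =
        c + utility q k y \<tau> i" for y \<tau> c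
    by (simp add: utility_def integrable_measure_pmf_finite)
  show ?thesis
    unfolding utility_def[of q "Suc k"] play.simps
    by (subst pmf_expectation_bind[OF finite_set_pmf_round _ order_refl])
       (auto simp: * integral_measure_pmf[OF finite_set_pmf_round])
qed

lemma update_contest: "update_reputation x (\<lambda>j. if (j = Player1) = b then Some Stronger else None) =
   wins (if b then Player1 else Player2) x"
  by (auto simp: update_reputation_def wins_def fun_eq_iff) (metis player.exhaust)+

lemma update_split: "update_reputation x (\<lambda>j. Some (lower_offers x Weaker j)) =
   wins (higher x) x"
  by (auto simp: update_reputation_def wins_def lower_offers_def fun_eq_iff)

lemma utility_contest:
  assumes "all_pos x"
  shows "utility q (Suc k) x (play_first (lower_offers x Stronger)
     (\<lambda>h. \<sigma> (update_reputation x h))) i =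
     share i x + urn (\<lambda>y. utility q k y (\<sigma> y) i) x"
proof -
  have p: "real (x Player1) / (real (x Player1) + real (x Player2)) = share Player1 x"
    by (simp add: share_def rep_sum_def)
  have o: "share Player2 x = 1 - share Player1 x"
    using share_other[OF assms, of Player1] by simp
  have c: "lower_offers x Stronger = (\<lambda>i. Stronger)" by (auto simp: lower_offers_def)
  show ?thesis
    unfolding utility_Suc
    by (cases i)
       (simp_all add: play_first_def round_outcome_def c p payoff_def update_contest urn_def o
         algebra_simps)
qed

lemma utility_split:
  "utility q (Suc k) x (play_first (lower_offers x Weaker)
     (\<lambda>h. \<sigma> (update_reputation x h))) i =
     (if i = higher x then 1 else q) + utility q k (wins (higher x) x) (\<sigma> (wins (higher x) x)) i"
proof -
  have "lower_offers x Weaker Player1 \<noteq> lower_offers x Weaker Player2"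
    by (auto simp: lower_offers_def higher_def)
  then show ?thesis
    unfolding utility_Suc
    using update_split[of x]
    by (simp add: play_first_def round_outcome_def payoff_def) (simp add: lower_offers_def)
qed

definition val :: "real \<Rightarrow> player \<Rightarrow> nat \<Rightarrow> reputation \<Rightarrow> real" where
  "val q i k x = utility q k x (canonical q k x) i"

text \<open>Index convention: this is the decision made in a round that is followed by \<open>k\<close> more rounds.\<close>

definition contest :: "real \<Rightarrow> nat \<Rightarrow> reputation \<Rightarrow> bool" where
  "contest q k x \<longleftrightarrow> q + val q (lower x) k (wins (higher x) x) <
     share (lower x) x + urn (val q (lower x) k) x"

lemma val_0 [simp]: "val q i 0 x = 0"
  by (simp add: val_def)

text \<open>This recursion replaces the space of outcome lists: the later analysis of payoffs rests
  on it alone.\<close>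

lemma val_Suc:
  assumes "all_pos x"
  shows "val q i (Suc k) x =
    (if contest q k x then share i x + urn (val q i k) x
     else (if i = higher x then 1 else q) + val q i k (wins (higher x) x))"
proof -
  note c = utility_contest[OF assms, where \<sigma> = "canonical q k"]
  note s = utility_split[where \<sigma> = "canonical q k"]
  have v: "(\<lambda>y. utility q k y (canonical q k y) j) = val q j k" for j
    by (simp add: val_def fun_eq_iff)
  have ll: "lower x \<noteq> higher x" by (simp add: higher_or_lower)
  show ?thesis
    unfolding val_def[of q i "Suc k"]
    by (simp add: c s v contest_def ll Let_def) (simp add: val_def)
qed

subsection \<open>Few contests when the shares are far apart\<close>

lemma share_wins:
  "share i (wins i x) = (real (x i) + 1) / (real (rep_sum x) + 1)"
  "share i (wins (other i) x) = real (x i) / (real (rep_sum x) + 1)"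
  by (simp_all add: share_def add_ac)

lemma rep_le_sum: "x i \<le> rep_sum x"
  using rep_sum_eq[of x i] by simp

lemma share_wins_mono:
  assumes "all_pos x"
  shows "share i x \<le> share i (wins i x)" "share i (wins (other i) x) < share i x"
    "share i (wins (other i) x) \<le> share i (wins i x)"
  unfolding share_wins using rep_le_sum[of x i] rep_sum_pos[OF assms] all_posD[OF assms, of i]
  by (simp_all add: share_def field_simps)

lemma share_higher:
  assumes "all_pos x"
  shows "1 / 2 \<le> share (higher x) x"
proof -
  have "real (rep_sum x) \<le> 2 * real (x (higher x))"
    using rep_sum_eq[of x "higher x"] higher_ge[of x "other (higher x)"] by simp
  then show ?thesis using rep_sum_pos[OF assms] by (simp add: share_def field_simps)
qed

lemma urn_diff:
  assumes "all_pos x"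
  shows "urn g x = g (wins (other i) x) + share i x * (g (wins i x) - g (wins (other i) x))"
  unfolding urn_eq[of _ _ i] share_other[OF assms] by (simp add: algebra_simps)

lemma val_lower:
  assumes "all_pos x" and "i \<noteq> higher x"
  shows "val q i (Suc k) x =
    max (share i x + urn (val q i k) x) (q + val q i k (wins (higher x) x))"
proof -
  have "i = lower x" using assms(2) by (simp add: higher_or_lower eq_other_iff)
  then show ?thesis
    using assms by (auto simp: val_Suc contest_def)
qed

text \<open>Contesting in every round would earn exactly the share per round, by the martingale
  property. The lower player does at least as well by choice; the higher player gains from an
  uncontested round, which pays 1 and raises its share.\<close>

lemma val_ge_share:
  assumes "all_pos x"
  shows "real k * share i x \<le> val q i k x"
  using assms
proof (induction k arbitrary: x)
  case 0
  then show ?case by simp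
next
  case (Suc k)
  have "real k * share i x = urn (\<lambda>y. 0 + real k * share i y) x"
    by (simp only: urn_affine[OF Suc.prems] urn_share[OF Suc.prems])
  also have "\<dots> \<le> urn (val q i k) x"
    by (rule urn_mono) (use Suc in simp)
  finally have c: "real (Suc k) * share i x \<le> share i x + urn (val q i k) x"
    by (simp add: algebra_simps)
  have "real k * share i x \<le> real k * share i (wins i x)"
    using share_wins_mono(1)[OF Suc.prems] by (simp add: mult_left_mono)
  also have "\<dots> \<le> val q i k (wins i x)"
    using Suc by simp
  finally have s: "real (Suc k) * share i x \<le> 1 + val q i k (wins i x)"
    using share_le_1[of i x] unfolding of_nat_Suc distrib_right by linarith
  show ?case
  proof (cases "i = higher x")
    case True
    then show ?thesis using c s Suc.prems by (simp add: val_Suc)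
  next
    case False
    then show ?thesis using c Suc.prems by (simp add: val_lower)
  qed
qed

lemma higher_wins_neq: "i \<noteq> higher x \<Longrightarrow> i \<noteq> higher (wins (higher x) x)"
  by (simp add: higher_wins_higher)

text \<open>Giving way in every round is always open to the lower player, and it stays the lower
  player by doing so.\<close>

lemma val_ge_q:
  assumes "all_pos x" and "i \<noteq> higher x"
  shows "real k * q \<le> val q i k x"
  using assms
proof (induction k arbitrary: x)
  case (Suc k)
  then have "real k * q \<le> val q i k (wins (higher x) x)"
    using higher_wins_neq by simp
  then show ?case using Suc.prems by (simp add: val_lower algebra_simps max_def)
qed simp

lemma urn_le_const:
  assumes "all_pos x" "\<And>i. g (wins i x) \<le> a"
  shows "urn g x \<le> a"
  using urn_mono[of g x "\<lambda>_. a"] assms urn_affine[of x a 0] by simp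

lemma val_le:
  assumes "all_pos x" and "q \<le> 1"
  shows "val q i k x \<le> real k"
  using assms(1)
proof (induction k arbitrary: x)
  case (Suc k)
  have "urn (val q i k) x \<le> real k"
    by (rule urn_le_const) (use Suc in auto)
  moreover have "val q i k (wins (higher x) x) \<le> real k" using Suc by simp
  ultimately show ?case
    using Suc.prems assms(2) add_mono[OF share_le_1[of i x]] by (auto simp: val_Suc)
qed simp

text \<open>The expected number of contested rounds. It determines the welfare because the stronger
  candidate is hired in every round, and the weaker one exactly in the uncontested rounds.\<close>

primrec contests :: "real \<Rightarrow> nat \<Rightarrow> reputation \<Rightarrow> real" where
  "contests q 0 = (\<lambda>_. 0)"
| "contests q (Suc k) = (\<lambda>x. if contest q k x then 1 + urn (contests q k) x
     else contests q k (wins (higher x) x))"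

lemma contests_le:
  assumes "all_pos x"
  shows "contests q k x \<le> real k"
  using assms
proof (induction k arbitrary: x)
  case (Suc k)
  have "urn (contests q k) x \<le> real k"
    by (rule urn_le_const) (use Suc in auto)
  moreover have "contests q k (wins (higher x) x) \<le> real k" using Suc by simp
  ultimately show ?case by simp
qed simp

lemma contests_nonneg: "0 \<le> contests q k x"
  by (induction k arbitrary: x) (auto simp: urn_def intro!: add_nonneg_nonneg)

lemma welfare_contests:
  assumes "all_pos x"
  shows "val q Player1 k x + val q Player2 k x = real k * (1 + q) - q * contests q k x"
  using assms
proof (induction k arbitrary: x)
  case (Suc k)
  have "share Player1 x + share Player2 x = 1"
    using share_other[OF Suc.prems, of Player1] by simp
  moreover have "urn (val q Player1 k) x + urn (val q Player2 k) x =
      urn (\<lambda>y. val q Player1 k y + val q Player2 k y) x"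
    by (simp add: urn_add)
  moreover have "\<dots> = urn (\<lambda>y. real k * (1 + q) + (- q) * contests q k y) x"
    using Suc by (simp add: urn_def)
  moreover have "\<dots> = real k * (1 + q) - q * urn (contests q k) x"
    unfolding urn_affine[OF Suc.prems] by simp
  moreover have "(if Player1 = higher x then 1 else q) + (if Player2 = higher x then 1 else q) = 1 + q"
    by (cases "higher x") auto
  ultimately show ?case
    using Suc.IH[of "wins (higher x) x"] Suc.prems
    by (cases "contest q k x") (simp_all add: val_Suc algebra_simps split del: if_split)
qed simp

text \<open>The summand \<open>1 / rep_sum x\<close> makes up for the variance of the later urn steps, which turns
  the squared excess of a share over \<open>c\<close> into a supermartingale.\<close>

definition pot :: "player \<Rightarrow> real \<Rightarrow> reputation \<Rightarrow> real" where
  "pot i c x = (max 0 (share i x - c))\<^sup>2 + 1 / rep_sum x"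

lemma pot_nonneg: "0 \<le> pot i c x"
  by (simp add: pot_def)

lemma max_0_add_power2_le: "(max 0 (u + t))\<^sup>2 \<le> (max 0 u + t)\<^sup>2" for u t :: real
proof (cases "u + t \<le> 0")
  case False
  then show ?thesis by (intro power_mono) auto
qed simp

lemma urn_pot:
  assumes "all_pos x"
  shows "urn (pot i c) x \<le> pot i c x"
proof -
  define n where "n = real (rep_sum x)"
  define p where "p = share i x"
  define e where "e = 1 / (n + 1)"
  define m where "m = max 0 (p - c)"
  have n: "n > 0" using rep_sum_pos[OF assms] by (simp add: n_def)
  have xi: "real (x i) = p * n" using n by (simp add: p_def n_def share_def)
  have p: "0 \<le> p" "p \<le> 1" by (auto simp: p_def)
  have s1: "share i (wins i x) = p + (1 - p) * e"
    unfolding share_wins xi n_def[symmetric] using n by (simp add: e_def field_simps)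
  have s2: "share i (wins (other i) x) = p - p * e"
    unfolding share_wins xi n_def[symmetric] using n by (simp add: e_def field_simps)
  have ew: "1 / real (rep_sum (wins j x)) = e" for j
    by (simp add: e_def n_def add_ac)
  have "pot i c (wins i x) \<le> (m + (1 - p) * e)\<^sup>2 + e"
    using max_0_add_power2_le[of "p - c" "(1 - p) * e"]
    unfolding pot_def s1 ew m_def by (simp add: algebra_simps)
  moreover have "pot i c (wins (other i) x) \<le> (m - p * e)\<^sup>2 + e"
    using max_0_add_power2_le[of "p - c" "- p * e"]
    unfolding pot_def s2 ew m_def by (simp add: algebra_simps)
  ultimately have "urn (pot i c) x \<le> p * ((m + (1 - p) * e)\<^sup>2 + e) + (1 - p) * ((m - p * e)\<^sup>2 + e)"
    unfolding urn_eq[of _ _ i] share_other[OF assms] p_def[symmetric]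
    using p by (intro add_mono mult_left_mono) auto
  \<comment> \<open>The increments of the share have mean zero, so the cross terms cancel and only
    the variance \<open>p * (1 - p) * e\<^sup>2\<close> remains.\<close>
  also have "\<dots> = m\<^sup>2 + p * (1 - p) * e\<^sup>2 + e"
    by (simp add: algebra_simps power2_eq_square)
  also have "\<dots> \<le> m\<^sup>2 + 1 * e\<^sup>2 + e"
    using p by (intro add_mono mult_right_mono mult_le_one) auto
  \<comment> \<open>The drop from \<open>1 / n\<close> to \<open>1 / (n + 1)\<close> is
    \<open>1 / (n * (n + 1))\<close>, enough to pay for the variance.\<close>
  also have "e\<^sup>2 + e \<le> 1 / n"
    using n by (simp add: e_def power2_eq_square divide_simps) (simp add: algebra_simps)
  then have "m\<^sup>2 + 1 * e\<^sup>2 + e \<le> m\<^sup>2 + 1 / n" by simp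
  finally show ?thesis by (simp add: pot_def m_def p_def n_def)
qed

lemma pot_wins_other:
  assumes "all_pos x"
  shows "pot i c (wins (other i) x) \<le> pot i c x"
  unfolding pot_def using share_wins_mono(2)[OF assms, of i] rep_sum_pos[OF assms]
  by (intro add_mono power_mono) (auto simp: field_simps)

lemma pot_large:
  assumes "c + d \<le> share i x" "0 \<le> d"
  shows "d\<^sup>2 \<le> pot i c x"
proof -
  have "d\<^sup>2 \<le> (max 0 (share i x - c))\<^sup>2" using assms by (intro power_mono) auto
  also have "\<dots> \<le> pot i c x" by (simp add: pot_def)
  finally show ?thesis .
qed

text \<open>While the share of player \<open>i\<close> is below \<open>c + d\<close>, each contested round costs this player at
  least \<open>d\<close> compared with the safe payoff \<open>q\<close>; leaving that range is paid for by the potential.\<close>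

lemma val_contests_upper:
  assumes "all_pos x" and "0 < d" and "d \<le> 1" and "0 \<le> q" and "q \<le> 1"
    and "c + 2 * d \<le> q" and "c + d \<le> 1 / 2"
  shows "val q i k x + d * contests q k x \<le> real k * (q + 2 / d\<^sup>2 * pot i c x)"
  using assms(1)
proof (induction k arbitrary: x)
  case (Suc k)
  show ?case
  proof (cases "c + d \<le> share i x")
    case True
    \<comment> \<open>Trivial bounds suffice here: \<open>val\<close> and \<open>contests\<close>
      are each at most the number of rounds, while the potential is at least
      \<open>d\<^sup>2\<close>. This is the source of the factor
      \<open>2 / d\<^sup>2\<close>.\<close>
    have "val q i (Suc k) x + d * contests q (Suc k) x \<le> real (Suc k) + 1 * real (Suc k)"
      by (intro add_mono mult_mono val_le contests_le contests_nonneg Suc.prems assms) auto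
    also have "\<dots> \<le> real (Suc k) * (q + 2 * 1)"
      using assms by (simp add: algebra_simps)
    also have "\<dots> \<le> real (Suc k) * (q + 2 * (pot i c x / d\<^sup>2))"
      using pot_large[OF True] assms by (intro mult_left_mono add_left_mono) auto
    finally show ?thesis by simp
  next
    case False
    then have l: "i \<noteq> higher x" using share_higher[OF Suc.prems] assms by auto
    then have o: "higher x = other i" by (simp add: eq_other_iff)
    show ?thesis
    proof (cases "contest q k x")
      case True
      have "urn (val q i k) x + d * urn (contests q k) x =
          urn (\<lambda>y. val q i k y + d * contests q k y) x"
        by (simp add: urn_def algebra_simps)
      also have "\<dots> \<le> urn (\<lambda>y. real k * q + real k * (2 / d\<^sup>2) * pot i c y) x"
        using Suc by (intro urn_mono) (simp add: algebra_simps)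
      also have "\<dots> = real k * q + real k * (2 / d\<^sup>2) * urn (pot i c) x"
        by (rule urn_affine[OF Suc.prems])
      also have "\<dots> \<le> real k * q + real k * (2 / d\<^sup>2) * pot i c x"
        using urn_pot[OF Suc.prems] by (intro add_left_mono mult_left_mono) auto
      finally have "val q i (Suc k) x + d * contests q (Suc k) x \<le>
          share i x + d + real k * (q + 2 / d\<^sup>2 * pot i c x)"
        using True Suc.prems by (simp add: val_Suc algebra_simps)
      \<comment> \<open>The share is below \<open>c + d\<close>, so \<open>share i x + d\<close> is
        below \<open>c + 2 * d\<close>, hence below \<open>q\<close>.\<close>
      also have "\<dots> \<le> (q + 2 / d\<^sup>2 * pot i c x) + real k * (q + 2 / d\<^sup>2 * pot i c x)"
        using False assms pot_nonneg[of i c x]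
        by (intro add_right_mono) (auto intro!: add_increasing2 divide_nonneg_nonneg)
      finally show ?thesis by (simp only: of_nat_Suc distrib_right mult_1_left)
    next
      case F: False
      have "val q i (Suc k) x + d * contests q (Suc k) x \<le>
          q + real k * (q + 2 / d\<^sup>2 * pot i c (wins (other i) x))"
        using F l o Suc by (simp add: val_Suc)
      also have "\<dots> \<le> (q + 2 / d\<^sup>2 * pot i c x) + real k * (q + 2 / d\<^sup>2 * pot i c x)"
        using pot_nonneg[of i c x] pot_wins_other[OF Suc.prems]
        by (intro add_mono mult_left_mono) auto
      finally show ?thesis by (simp only: of_nat_Suc distrib_right mult_1_left)
    qed
  qed
qed simp

text \<open>The lower player secures \<open>k * q\<close>, so in the previous bound only the
  potential is left to pay for contests. As the share is at most \<open>c\<close>, that potential is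
  just \<open>1 / rep_sum x\<close>.\<close>

lemma contests_upper:
  assumes "all_pos x" and "0 < d" and "d \<le> 1" and "0 \<le> q" and "q \<le> 1"
    and "c + 2 * d \<le> q" and "c + d \<le> 1 / 2" and "share i x \<le> c"
  shows "contests q k x \<le> real k * (2 / d ^ 3 / rep_sum x)"
proof -
  have l: "i \<noteq> higher x" using share_higher[OF assms(1)] assms by auto
  have "pot i c x = 1 / rep_sum x" using assms by (simp add: pot_def)
  then have "d * contests q k x \<le> real k * (2 / d\<^sup>2 * (1 / rep_sum x))"
    using val_contests_upper[OF assms(1-7), where i = i and k = k] val_ge_q[OF assms(1) l, of k q]
    by (simp add: algebra_simps)
  then have "contests q k x \<le> real k * (2 / d\<^sup>2 * (1 / rep_sum x)) / d"
    using \<open>0 < d\<close> by (metis pos_le_divide_eq mult.commute)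
  then show ?thesis
    by (simp add: power2_eq_square power3_eq_cube mult_ac)
qed

subsection \<open>Monotonicity and persistence of giving way\<close>

lemma urn_between:
  assumes "all_pos x" and "g (wins (other i) x) \<le> g (wins i x)"
  shows "g (wins (other i) x) \<le> urn g x" and "urn g x \<le> g (wins i x)"
proof -
  have "share i x * (g (wins i x) - g (wins (other i) x)) \<le> 1 * (g (wins i x) - g (wins (other i) x))"
    using assms(2) by (intro mult_right_mono) auto
  moreover have "0 \<le> share i x * (g (wins i x) - g (wins (other i) x))"
    using assms(2) by simp
  ultimately show "g (wins (other i) x) \<le> urn g x" and "urn g x \<le> g (wins i x)"
    unfolding urn_diff[OF assms(1), of g i] by simp_all
qed

text \<open>A predicate in \<open>k\<close>, so that the lemmas on a single round can take it as a
  hypothesis before the induction in \<open>val_mono_settled\<close> proves it.\<close>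

definition val_mono :: "real \<Rightarrow> nat \<Rightarrow> bool" where
  "val_mono q k \<longleftrightarrow> (\<forall>x i. all_pos x \<longrightarrow> val q i k (wins (other i) x) \<le> val q i k (wins i x))"

lemma val_monoD:
  "val_mono q k \<Longrightarrow> all_pos x \<Longrightarrow> val q i k (wins (other i) x) \<le> val q i k (wins i x)"
  by (simp add: val_mono_def)

lemma contest_value_le:
  assumes "val_mono q k" and "all_pos x"
  shows "share i x + urn (val q i k) x \<le> val q i (Suc k) x"
proof (cases "i = higher x")
  case True
  have "urn (val q i k) x \<le> val q i k (wins i x)"
    by (rule urn_between(2)[OF assms(2) val_monoD[OF assms]])
  then show ?thesis using assms add_mono[OF share_le_1[of i x]] by (auto simp: val_Suc True[symmetric])
qed (use assms in \<open>simp add: val_lower\<close>)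

text \<open>For the lower player this is one of its options. For the higher player contesting
  already beats it: its share is at least 1/2, hence at least \<open>q\<close>, and losing is the
  worse of the two successors.\<close>

lemma split_value_le:
  assumes "val_mono q k" and "all_pos x" and "q \<le> 1 / 2"
  shows "q + val q i k (wins (other i) x) \<le> val q i (Suc k) x"
proof (cases "i = higher x")
  case True
  have "val q i k (wins (other i) x) \<le> urn (val q i k) x"
    by (rule urn_between(1)[OF assms(2) val_monoD[OF assms(1,2)]])
  then show ?thesis
    using contest_value_le[OF assms(1,2), of i] share_higher[OF assms(2)] assms(3) True by simp
next
  case False
  then have "higher x = other i" by (simp add: eq_other_iff)
  then show ?thesis using False assms by (simp add: val_lower)
qed

text \<open>The state in which both players have won once is the best successor of
  \<open>wins (other i) x\<close> and the worst successor of \<open>wins i x\<close>, so it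
  separates the two means.\<close>

lemma contest_value_mono:
  assumes "val_mono q k" and "all_pos x"
  shows "share i (wins (other i) x) + urn (val q i k) (wins (other i) x) \<le>
         share i (wins i x) + urn (val q i k) (wins i x)"
proof -
  let ?f = "val q i k" and ?a = "wins (other i) x" and ?b = "wins i x"
  have p: "all_pos ?a" "all_pos ?b" using assms(2) by auto
  note m = val_monoD[OF assms(1), of _ i]
  have c: "wins i ?a = wins (other i) ?b" by (rule wins_commute)
  have "urn ?f ?a \<le> ?f (wins i ?a)"
    by (rule urn_between(2)[OF p(1) m[OF p(1)]])
  also have "\<dots> \<le> urn ?f ?b"
    unfolding c by (rule urn_between(1)[OF p(2) m[OF p(2)]])
  finally show ?thesis using share_wins_mono(3)[OF assms(2), of i] by simp
qed

text \<open>Both options of \<open>i\<close> at \<open>?a\<close> are matched at \<open>?b\<close>,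
  whichever role \<open>i\<close> has there.\<close>

lemma val_mono_Suc_lower:
  assumes "val_mono q k" and "all_pos x" and "q \<le> 1 / 2" and "i \<noteq> higher (wins (other i) x)"
  shows "val q i (Suc k) (wins (other i) x) \<le> val q i (Suc k) (wins i x)"
proof -
  let ?a = "wins (other i) x" and ?b = "wins i x"
  have p: "all_pos ?a" "all_pos ?b" using assms(2) by auto
  have h: "higher ?a = other i" using assms(4) by (metis eq_other_iff)
  have "q + val q i k (wins (other i) ?a) \<le> q + val q i k (wins i ?a)"
    using val_monoD[OF assms(1) p(1)] by simp
  also have "\<dots> = q + val q i k (wins (other i) ?b)"
    by (simp add: wins_commute)
  also have "\<dots> \<le> val q i (Suc k) ?b"
    by (rule split_value_le[OF assms(1) p(2) assms(3)])
  finally show ?thesis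
    using contest_value_mono[OF assms(1,2), of i] contest_value_le[OF assms(1) p(2), of i]
    by (simp add: val_lower[OF p(1) assms(4)] h)
qed

text \<open>That an uncontested round is never followed by a contested one is an exchange argument:
  contesting now and giving way in the next round beats the opposite order, since the share of
  the lower player shrinks when it gives way.\<close>

lemma val_mono_settled:
  assumes "0 < q" and "q \<le> 1 / 2"
  shows "val_mono q k \<and>
    (\<forall>x. all_pos x \<longrightarrow> \<not> contest q k x \<longrightarrow> val q (lower x) (Suc k) x = real (Suc k) * q)"
proof (induction k)
  case 0
  show ?case by (auto simp: val_mono_def val_Suc higher_or_lower)
next
  case (Suc k)
  then have mono: "val_mono q k" and settled:
    "\<And>x. all_pos x \<Longrightarrow> \<not> contest q k x \<Longrightarrow> val q (lower x) (Suc k) x = real (Suc k) * q"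
    by auto
  note lowm = val_mono_Suc_lower[OF mono _ assms(2)]
  have "val_mono q (Suc k)"
    unfolding val_mono_def
  proof (intro allI impI)
    fix x i assume x: "all_pos x"
    let ?a = "wins (other i) x" and ?b = "wins i x"
    have p: "all_pos ?a" "all_pos ?b" using x by auto
    show "val q i (Suc k) ?a \<le> val q i (Suc k) ?b"
    proof (cases "i = higher ?a")
      case False
      then show ?thesis by (rule lowm[OF x])
    next
      case True
      then have ha: "higher ?a = i" and hb: "higher ?b = i" using higher_mono by metis+
      show ?thesis
      proof (cases "contest q k ?a")
        case True
        then show ?thesis
          using contest_value_mono[OF mono x, of i] contest_value_le[OF mono p(2), of i] p(1)
          by (simp add: val_Suc)
      next
        case False
        let ?j = "other i"
        have la: "lower ?a = ?j" and lb: "lower ?b = ?j"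
          by (simp_all add: higher_or_lower(2) ha hb)
        \<comment> \<open>Having given way at \<open>?a\<close>, the player \<open>?j\<close> is
          worth exactly \<open>Suc k * q\<close> there, and no more at \<open>?b\<close>. Giving way
          at \<open>?b\<close> secures that amount, so \<open>?j\<close> gives way there too and the
          two uncontested values can be compared.\<close>
        have "val q ?j (Suc k) ?b \<le> val q ?j (Suc k) ?a"
          using lowm[OF x, of ?j] by (simp add: hb)
        also have "\<dots> = real (Suc k) * q"
          using settled[OF p(1) False] la by simp
        also have "\<dots> \<le> q + val q ?j k (wins i ?b)"
          using val_ge_q[of "wins i ?b" ?j k q] p hb higher_wins_higher[of ?b]
          by (simp add: algebra_simps)
        finally have "\<not> contest q k ?b"
          using p hb lb by (auto simp: val_Suc contest_def)
        then show ?thesis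
          using False ha hb p val_monoD[OF mono p(2), of i] wins_commute[of i "other i" x]
          by (simp add: val_Suc)
      qed
    qed
  qed
  moreover have "val q (lower x) (Suc (Suc k)) x = real (Suc (Suc k)) * q"
    if x: "all_pos x" and nc: "\<not> contest q (Suc k) x" for x
  proof -
    define h where "h = higher x"
    define l where "l = lower x"
    have l: "other h = l" "other l = h" by (simp_all add: h_def l_def higher_or_lower(2))
    have hn: "higher (wins h x) = h" "lower (wins h x) = l"
      unfolding higher_or_lower(2) l_def by (simp_all add: h_def higher_wins_higher)
    have p: "all_pos (wins h x)" "all_pos (wins l x)" using x by auto
    have "\<not> contest q k (wins h x)"
    proof
      assume c: "contest q k (wins h x)"
      let ?F = "val q l k"
      \<comment> \<open>Giving way and contesting once each, in either order, leads to the same two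
        states. Their values for \<open>l\<close> are \<open>w\<close> if it won the contest and
        \<open>v\<close> if it lost.\<close>
      define w where "w = ?F (wins l (wins h x))"
      define v where "v = ?F (wins h (wins h x))"
      have vw: "v \<le> w" using val_monoD[OF mono p(1), of l] unfolding v_def w_def l .
      have eq: "val q l (Suc k) (wins h x) = v + share l (wins h x) * (1 + w - v)"
        using c p urn_diff[OF p(1), of ?F l]
        by (simp add: val_Suc v_def w_def l(2) algebra_simps)
      have 1: "q + w \<le> val q l (Suc k) (wins l x)"
        using split_value_le[OF mono p(2) assms(2), of l]
        by (simp add: w_def l(2) wins_commute)
      have 2: "q + v \<le> val q l (Suc k) (wins h x)"
        using split_value_le[OF mono p(1) assms(2), of l] by (simp add: v_def l(2))
      \<comment> \<open>The contest is won with larger probability before giving way than after it,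
        and the stake \<open>1 + w - v\<close> is positive.\<close>
      have "share l (wins h x) * (1 + w - v) < share l x * (1 + w - v)"
        using share_wins_mono(2)[OF x, of l] vw unfolding l by (intro mult_strict_right_mono) auto
      then have "q + val q l (Suc k) (wins h x) < q + v + share l x * (1 + w - v)"
        unfolding eq by simp
      also have "\<dots> = share l x + (share l x * (q + w) + (1 - share l x) * (q + v))"
        by (simp add: algebra_simps)
      also have "\<dots> = share l x + (share l x * (q + w) + share h x * (q + v))"
        using share_other[OF x, of l] unfolding l by simp
      also have "\<dots> \<le> share l x + urn (val q l (Suc k)) x"
        unfolding urn_eq[of _ _ l] l(2) using 1 2
        by (intro add_left_mono add_mono mult_left_mono) auto
      finally show False using nc by (simp add: contest_def h_def l_def)
    qed
    then have "val q l (Suc k) (wins h x) = real (Suc k) * q"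
      using settled[OF p(1)] hn by simp
    moreover have "l \<noteq> h" using l(2) by auto
    ultimately have "val q l (Suc (Suc k)) x = q + real (Suc k) * q"
      using nc by (simp only: val_Suc[OF x] h_def[symmetric] if_False)
    then show ?thesis by (simp add: l_def algebra_simps)
  qed
  ultimately show ?case by auto
qed

lemmas val_mono = val_mono_settled[THEN conjunct1]
  and val_settled = val_mono_settled[THEN conjunct2, rule_format]

section \<open>Lower bounds on contesting\<close>

lemma share_le_if_not_contest:
  assumes "0 < q" and "q \<le> 1 / 2" and "all_pos x" and "\<not> contest q k x"
  shows "share (lower x) x \<le> q"
proof -
  \<comment> \<open>A contest never worsens the future compared with giving way, so only a current
    payoff \<open>q\<close> at least as large as the share can justify giving way.\<close>
  have "val q (lower x) k (wins (higher x) x) \<le> val q (lower x) k (wins (lower x) x)"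
    using val_monoD[OF val_mono[OF assms(1,2)] assms(3), of "lower x"]
    by (simp add: higher_or_lower)
  then have "0 \<le> share (lower x) x * (val q (lower x) k (wins (lower x) x) - val q (lower x) k (wins (higher x) x))"
    by simp
  then show ?thesis
    using assms(4) urn_diff[OF assms(3), of "val q (lower x) k" "lower x"]
    by (simp add: contest_def higher_or_lower)
qed

text \<open>A round is uncontested only if the higher share is at least \<open>1 - q\<close>; then a
  potential is at least \<open>d\<^sup>2\<close> and the bound is not positive. Until then the
  potentials are supermartingales.\<close>

lemma contests_lower:
  assumes "0 < q" and "q \<le> 1 / 2" and "all_pos x" and "0 < d"
  shows "real k * (1 - (pot Player1 (1 - q - d) x + pot Player2 (1 - q - d) x) / d\<^sup>2) \<le> contests q k x"
  using assms(3)
proof (induction k arbitrary: x)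
  case (Suc k)
  define g where "g y = pot Player1 (1 - q - d) y + pot Player2 (1 - q - d) y" for y
  have pot_le: "pot j (1 - q - d) y \<le> g y" for j y
    using pot_nonneg by (cases j) (auto simp: g_def)
  have gn: "0 \<le> g y" for y using pot_nonneg by (simp add: g_def)
  show ?case
  proof (cases "contest q k x")
    case True
    have "real (Suc k) * (1 - g x / d\<^sup>2) \<le> 1 + (real k + - (real k / d\<^sup>2) * g x)"
      using gn[of x] by (simp add: algebra_simps add_divide_distrib)
    also have "\<dots> \<le> 1 + (real k + - (real k / d\<^sup>2) * urn g x)"
      using urn_pot[OF Suc.prems] unfolding g_def urn_add
      by (intro add_left_mono mult_left_mono_neg add_mono) auto
    also have "\<dots> = 1 + urn (\<lambda>y. real k + - (real k / d\<^sup>2) * g y) x"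
      by (simp only: urn_affine[OF Suc.prems])
    also have "\<dots> \<le> 1 + urn (contests q k) x"
      using Suc.IH[OF all_pos_wins[OF Suc.prems]]
      by (intro add_left_mono urn_mono) (simp add: g_def right_diff_distrib)
    finally show ?thesis using True by (simp add: g_def)
  next
    case False
    have "1 - share (higher x) x \<le> q"
      using share_le_if_not_contest[OF assms(1,2) Suc.prems False] share_other[OF Suc.prems, of "higher x"]
      by (simp add: higher_or_lower(2))
    then have "d\<^sup>2 \<le> g x"
      using pot_large[of "1 - q - d" d "higher x" x] pot_le[of "higher x" x] assms by simp
    then have "1 - g x / d\<^sup>2 \<le> 0" using assms by simp
    then have "real (Suc k) * (1 - g x / d\<^sup>2) \<le> 0" by (simp add: mult_nonneg_nonpos)
    then show ?thesis using contests_nonneg[of q "Suc k" x] unfolding g_def by linarith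
  qed
qed simp

text \<open>With positive probability a player wins enough contests in a row to lift its share above
  \<open>q\<close>, and from then on it earns more than \<open>q\<close> per round; otherwise
  \<open>q\<close> per round is still secured. The constant \<open>C\<close> absorbs the rounds
  spent.\<close>

lemma val_linear_gain:
  assumes "0 < q" and "q < 1 / 2" and "all_pos x"
  shows "\<exists>e > 0. \<exists>C \<ge> 0. \<forall>k. real k * (q + e) - C \<le> val q i k x"
proof -
  \<comment> \<open>After \<open>n\<close> wins in a row the share exceeds \<open>q\<close>.\<close>
  obtain n where n: "real n > q * rep_sum x / (1 - q)" using reals_Archimedean2 by blast
  have "q * rep_sum x < real n * (1 - q)" using n assms by (simp add: field_simps)
  then have "q * (rep_sum x + n) < x i + n" by (simp add: algebra_simps)
  then show ?thesis
    using assms(3)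
  proof (induction n arbitrary: x)
    case 0
    then have "q < share i x" using rep_sum_pos[of x] by (simp add: share_def field_simps)
    then show ?case
      using val_ge_share[OF 0(2), of _ i q] by (intro exI[of _ "share i x - q"]) (auto intro: exI[of _ 0])
  next
    case (Suc n)
    show ?case
    proof (cases "q < share i x")
      case True
      then show ?thesis
        using val_ge_share[OF Suc.prems(2), of _ i q] by (intro exI[of _ "share i x - q"]) (auto intro: exI[of _ 0])
    next
      case False
      then have l: "i \<noteq> higher x" using share_higher[OF Suc.prems(2)] assms by auto
      then have h: "higher x = other i" by (simp add: eq_other_iff)
      obtain e C where e: "e > 0" "C \<ge> 0" "\<And>k. real k * (q + e) - C \<le> val q i k (wins i x)"
        using Suc.IH[of "wins i x"] Suc.prems by (auto simp: algebra_simps)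
      define p where "p = share i x"
      have p: "0 < p" "p \<le> 1" using Suc.prems by (auto simp: p_def)
      show ?thesis
      proof (intro exI conjI allI)
        show "p * e > 0" using p e by simp
        \<comment> \<open>The extra \<open>q + e\<close> covers the one round used for the contest,
          and the case \<open>k = 0\<close>.\<close>
        show "0 \<le> C + q + e" using e assms by simp
        fix k
        show "real k * (q + p * e) - (C + q + e) \<le> val q i k x"
        proof (cases k)
          case (Suc m)
          have "val q i m (wins (other i) x) \<ge> real m * q"
            using val_ge_q[of "wins (other i) x" i m q] higher_wins_neq[OF l] \<open>all_pos x\<close>
            by (simp add: h)
          then have "p * (real m * (q + e) - C) + (1 - p) * (real m * q) \<le> urn (val q i m) x"
            unfolding urn_eq[of _ _ i] share_other[OF \<open>all_pos x\<close>] p_def[symmetric]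
            using p e by (intro add_mono mult_left_mono) auto
          also have "\<dots> \<le> val q i k x"
            using val_lower[OF \<open>all_pos x\<close> l] p by (simp add: Suc p_def[symmetric] max_def)
          finally have "real m * (q + p * e) - p * C \<le> val q i k x" by (simp add: algebra_simps)
          moreover have "p * C \<le> C" "p * e \<le> e" using p e by (auto intro: mult_left_le_one_le)
          ultimately show ?thesis by (simp add: Suc algebra_simps)
        qed (use e assms in simp)
      qed
    qed
  qed
qed

text \<open>Giving way fixes the value at \<open>Suc k * q\<close>, by persistence. For large
  \<open>k\<close> this contradicts the linear gain.\<close>

lemma eventually_contest:
  assumes "0 < q" and "q < 1 / 2" and "all_pos x"
  shows "eventually (\<lambda>k. contest q k x) sequentially"
proof -
  obtain e C where e: "e > 0" "\<And>k. real k * (q + e) - C \<le> val q (lower x) k x"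
    using val_linear_gain[OF assms] by blast
  obtain k0 where k0: "real k0 > C / e" using reals_Archimedean2 by blast
  have "contest q k x" if "k \<ge> k0" for k
  proof (rule ccontr)
    assume "\<not> contest q k x"
    then have "val q (lower x) (Suc k) x = real (Suc k) * q"
      using val_settled[of q x k] assms by simp
    then have "real (Suc k) * e \<le> C" using e(2)[of "Suc k"] by (simp add: algebra_simps)
    moreover have "C < real k0 * e" using k0 e(1) by (simp add: field_simps)
    moreover have "real k0 * e \<le> real (Suc k) * e" using that e(1) by (intro mult_right_mono) auto
    ultimately show False by simp
  qed
  then show ?thesis by (auto simp: eventually_sequentially)
qed

subsection \<open>Averaging over the urn\<close>

text \<open>Among states of equal \<open>rep_sum\<close>, such a \<open>g\<close> is symmetric and
  increases towards equal reputations.\<close>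

definition unimodal :: "(reputation \<Rightarrow> real) \<Rightarrow> bool" where
  "unimodal g \<longleftrightarrow> (\<forall>x. all_pos x \<longrightarrow> g (x \<circ> other) = g x) \<and>
     (\<forall>x i. all_pos x \<longrightarrow> x i \<le> x (other i) \<longrightarrow> g (wins (other i) x) \<le> g (wins i x))"

lemma unimodalD:
  "unimodal g \<Longrightarrow> all_pos x \<Longrightarrow> x i \<le> x (other i) \<Longrightarrow> g (wins (other i) x) \<le> g (wins i x)"
  by (simp add: unimodal_def)

lemma all_pos_swap [simp]: "all_pos x \<Longrightarrow> all_pos (x \<circ> other)"
  by (simp add: all_pos_def)

lemma rep_sum_swap [simp]: "rep_sum (x \<circ> other) = rep_sum x"
  by (simp add: rep_sum_def)

lemma share_swap: "share i (x \<circ> other) = share (other i) x"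
  by (simp add: share_def)

lemma wins_swap: "wins i (x \<circ> other) = wins (other i) x \<circ> other"
  by (auto simp: wins_def fun_eq_iff) (metis other_other)

lemma urn_swap:
  assumes "\<And>x. all_pos x \<Longrightarrow> g (x \<circ> other) = g x" and "all_pos x"
  shows "urn g (x \<circ> other) = urn g x"
  using assms(1)[OF all_pos_wins[OF assms(2)]] by (simp add: urn_def wins_swap share_swap)

text \<open>From equal reputations the two successors are mirror images. Otherwise their common
  successor separates the two means.\<close>

lemma unimodal_urn:
  assumes "unimodal g"
  shows "unimodal (urn g)"
  unfolding unimodal_def
proof (intro conjI allI impI)
  have swap: "g (x \<circ> other) = g x" if "all_pos x" for x
    using assms that by (simp add: unimodal_def)
  have mono: "g (wins (other i) x) \<le> g (wins i x)" if "all_pos x" "x i \<le> x (other i)" for x i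
    using assms that by (simp add: unimodal_def)
  show "urn g (x \<circ> other) = urn g x" if "all_pos x" for x
    using urn_swap[of g x] swap that by simp
  show "urn g (wins (other i) x) \<le> urn g (wins i x)" if x: "all_pos x" and le: "x i \<le> x (other i)" for x i
  proof (cases "x i = x (other i)")
    case True
    then have "wins (other i) x = wins i x \<circ> other"
      by (cases i) (auto simp: wins_def fun_eq_iff all_player)
    then show ?thesis using urn_swap[of g "wins i x"] swap x by simp
  next
    case False
    have a: "all_pos (wins i x)" "all_pos (wins (other i) x)" using x by auto
    have "urn g (wins (other i) x) \<le> g (wins i (wins (other i) x))"
      by (rule urn_between(2)[OF a(2) mono[OF a(2)]]) (use le in simp)
    also have "\<dots> = g (wins (other i) (wins i x))" by (simp add: wins_commute)
    also have "\<dots> \<le> urn g (wins i x)"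
      by (rule urn_between(1)[OF a(1) mono[OF a(1)]]) (use le False in simp)
    finally show ?thesis .
  qed
qed

lemma unimodal_urn_iterate: "unimodal g \<Longrightarrow> unimodal ((urn ^^ j) g)"
  by (induction j) (auto intro: unimodal_urn)

lemma urn_iterate_nonneg: "(\<And>y. 0 \<le> g y) \<Longrightarrow> 0 \<le> (urn ^^ j) g x"
  by (induction j arbitrary: x) (auto simp: urn_def)

text \<open>An uncontested round moves the reputations apart, which only decreases a unimodal \<open>g\<close>;
  so the pure urn process is the worst case.\<close>

lemma contests_le_urn_iterate:
  assumes "unimodal g" and "\<And>y. 0 \<le> g y" and "\<And>k y. all_pos y \<Longrightarrow> contests q k y \<le> real k * g y"
    and "all_pos x"
  shows "contests q k x \<le> real j + real k * (urn ^^ j) g x"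
  using assms(4)
proof (induction j arbitrary: k x)
  case 0
  then show ?case using assms(3) by simp
next
  case (Suc j)
  define G where "G = (urn ^^ j) g"
  have G: "0 \<le> urn G x" using urn_iterate_nonneg[of g "Suc j"] assms(2) by (simp add: G_def)
  show ?case
  proof (cases k)
    case (Suc m)
    show ?thesis
    proof (cases "contest q m x")
      case True
      have "urn (contests q m) x \<le> urn (\<lambda>y. real j + real m * G y) x"
        using Suc.IH[OF all_pos_wins[OF Suc.prems]] by (intro urn_mono) (simp add: G_def)
      also have "\<dots> = real j + real m * urn G x" by (rule urn_affine[OF Suc.prems])
      finally show ?thesis using True Suc G by (simp add: G_def[symmetric] algebra_simps)
    next
      case False
      have "G (wins (higher x) x) \<le> urn G x"
        using urn_between(1)[OF Suc.prems, of G "lower x"] higher_ge[of x "lower x"]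
          unimodalD[OF unimodal_urn_iterate[OF assms(1)] Suc.prems, of "lower x" j]
        by (simp add: G_def higher_or_lower(2))
      then have "contests q m (wins (higher x) x) \<le> real j + real m * urn G x"
        using Suc.IH[of "wins (higher x) x" m] Suc.prems mult_left_mono[of "G (wins (higher x) x)" "urn G x" "real m"]
        unfolding G_def by fastforce
      then show ?thesis using False Suc G by (simp add: G_def[symmetric] algebra_simps)
    qed
  qed (use G in \<open>simp add: G_def\<close>)
qed

text \<open>Only finitely many states are reachable by contests within \<open>j\<close> rounds, and
  each is contested for all large \<open>k\<close>. So the first \<open>j\<close> rounds are pure
  urn steps, after which \<open>g\<close> bounds the rest.\<close>

lemma eventually_contests_ge_urn_iterate:
  assumes "0 < q" and "q < 1 / 2"
    and "\<And>k y. all_pos y \<Longrightarrow> real k * g y \<le> contests q k y" and "all_pos x"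
  shows "\<forall>\<^sub>F k in sequentially. (real k - real j) * (urn ^^ j) g x \<le> contests q k x"
  using assms(4)
proof (induction j arbitrary: x)
  case 0
  then show ?case using assms(3) by simp
next
  case (Suc j)
  define G where "G = (urn ^^ j) g"
  have "\<forall>\<^sub>F k in sequentially. (real k - real j) * G (wins i x) \<le> contests q k (wins i x)" for i
    using Suc by (simp add: G_def)
  then have "\<forall>\<^sub>F k in sequentially. \<forall>i. (real k - real j) * G (wins i x) \<le> contests q k (wins i x)"
    unfolding all_player by (simp add: eventually_conj)
  with eventually_contest[OF assms(1,2) Suc.prems]
  have "\<forall>\<^sub>F k in sequentially. (real (Suc k) - real (Suc j)) * urn G x \<le> contests q (Suc k) x"
  proof eventually_elim
    case (elim k)
    have "(real k - real j) * urn G x = urn (\<lambda>y. 0 + (real k - real j) * G y) x"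
      using urn_affine[OF Suc.prems, of 0] by simp
    also have "\<dots> \<le> urn (contests q k) x" using elim by (intro urn_mono) simp
    finally show ?case using elim by simp
  qed
  then show ?case unfolding G_def by (subst (asm) eventually_sequentially_Suc) simp
qed

section \<open>The uniform law of the urn and the counting of its states\<close>

lemma wins_reputations [simp]:
  "wins Player1 (reputations a b) = reputations (Suc a) b"
  "wins Player2 (reputations a b) = reputations a (Suc b)"
  by (auto simp: wins_def reputations_def fun_eq_iff split: player.split)

lemma share_reputations:
  "share Player1 (reputations a b) = a / (a + b)"
  "share Player2 (reputations a b) = b / (a + b)"
  by (simp_all add: share_def rep_sum_def reputations_def)

text \<open>In the induction the additional step is the last one. State \<open>a\<close> is then
  reached from \<open>a - 1\<close> with weight \<open>a\<close> and from \<open>a\<close> with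
  weight \<open>Suc j - a\<close>; the total \<open>Suc j\<close> does not depend on
  \<open>a\<close>.\<close>

lemma urn_iterate_uniform:
  "(urn ^^ j) g (reputations 1 1) = (\<Sum>a\<le>j. g (reputations (Suc a) (Suc (j - a)))) / (j + 1)"
proof (induction j arbitrary: g)
  case (Suc j)
  define G where "G a = g (reputations (Suc a) (Suc (Suc j - a)))" for a
  have "(urn ^^ Suc j) g (reputations 1 1) = (urn ^^ j) (urn g) (reputations 1 1)"
    by (simp only: funpow_Suc_right o_apply)
  also have "\<dots> = (\<Sum>a\<le>j. urn g (reputations (Suc a) (Suc (j - a)))) / (j + 1)"
    by (rule Suc.IH)
  also have "(\<Sum>a\<le>j. urn g (reputations (Suc a) (Suc (j - a)))) =
      (\<Sum>a\<le>j. (real (Suc a) * G (Suc a) + real (Suc j - a) * G a) / (j + 2))"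
  proof (rule sum.cong[OF refl])
    fix a assume "a \<in> {..j}"
    then obtain b where "j = a + b" by (auto dest: le_Suc_ex)
    then show "urn g (reputations (Suc a) (Suc (j - a))) =
        (real (Suc a) * G (Suc a) + real (Suc j - a) * G a) / (j + 2)"
      by (simp add: urn_def share_reputations G_def Suc_diff_le add_divide_distrib algebra_simps)
  qed
  also have "\<dots> = ((\<Sum>a\<le>j. real (Suc a) * G (Suc a)) + (\<Sum>a\<le>j. real (Suc j - a) * G a)) / (j + 2)"
    by (simp only: sum_divide_distrib[symmetric] sum.distrib)
  also have "(\<Sum>a\<le>j. real (Suc a) * G (Suc a)) = (\<Sum>a\<le>Suc j. real a * G a)"
    by (subst sum.atMost_Suc_shift) simp
  also have "(\<Sum>a\<le>j. real (Suc j - a) * G a) = (\<Sum>a\<le>Suc j. real (Suc j - a) * G a)"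
    by simp
  also have "(\<Sum>a\<le>Suc j. real a * G a) + (\<Sum>a\<le>Suc j. real (Suc j - a) * G a) = (\<Sum>a\<le>Suc j. (real j + 1) * G a)"
    unfolding sum.distrib[symmetric] by (rule sum.cong) (auto simp: of_nat_diff algebra_simps)
  also have "\<dots> = (real j + 1) * (\<Sum>a\<le>Suc j. G a)"
    by (simp only: sum_distrib_left)
  finally show ?case unfolding G_def[symmetric] by (simp add: add_ac del: sum.atMost_Suc)
qed simp

text \<open>By \<open>- 1 < u\<close> the ceiling of \<open>u\<close> is nonnegative, so the
  naturals in the interval are its integers.\<close>

lemma card_nat_interval:
  fixes u v :: real
  assumes "- 1 < u"
  shows "finite {a. u \<le> real a \<and> real a \<le> v}"
    and "v - u - 1 \<le> card {a. u \<le> real a \<and> real a \<le> v}"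
    and "u \<le> v + 1 \<Longrightarrow> card {a. u \<le> real a \<and> real a \<le> v} \<le> v - u + 1"
proof -
  let ?S = "{a. u \<le> real a \<and> real a \<le> v}"
  have i: "int ` ?S = {\<lceil>u\<rceil>..\<lfloor>v\<rfloor>}"
  proof (intro equalityI subsetI)
    fix z assume z: "z \<in> {\<lceil>u\<rceil>..\<lfloor>v\<rfloor>}"
    have "0 \<le> \<lceil>u\<rceil>" using assms by (simp add: le_ceiling_iff)
    then have "0 \<le> z" using z by (meson atLeastAtMost_iff order_trans)
    then have "z = int (nat z)" by simp
    moreover have "u \<le> real (nat z)" "real (nat z) \<le> v"
      using z \<open>0 \<le> z\<close> by (simp_all add: ceiling_le_iff le_floor_iff)
    ultimately show "z \<in> int ` ?S" by blast
  qed (auto simp: ceiling_le_iff le_floor_iff)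
  have c: "card ?S = nat (\<lfloor>v\<rfloor> - \<lceil>u\<rceil> + 1)"
    using card_image[of int ?S] unfolding i by simp
  show "finite ?S" using i finite_image_iff[of int ?S] by (simp add: inj_on_def)
  show "v - u - 1 \<le> card ?S" unfolding c by linarith
  show "card ?S \<le> v - u + 1" if "u \<le> v + 1" unfolding c using that by linarith
qed

text \<open>Bounds the proportion of contests by \<open>contests_upper\<close> at the edges and
  trivially by 1 in the middle. The cap \<open>min 1\<close> keeps the edges below the middle, as
  unimodality demands.\<close>

definition settled_bound :: "real \<Rightarrow> real \<Rightarrow> reputation \<Rightarrow> real" where
  "settled_bound c d x = (if \<exists>i. share i x \<le> c then min 1 (2 / d ^ 3 / rep_sum x) else 1)"

lemma unimodal_settled_bound: "unimodal (settled_bound c d)"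
  unfolding unimodal_def
proof (intro conjI allI impI)
  show "settled_bound c d (x \<circ> other) = settled_bound c d x" if "all_pos x" for x
    by (auto simp: settled_bound_def share_swap) (metis other_other)+
  fix x i assume x: "all_pos x" and le: "x i \<le> x (other i)"
  \<comment> \<open>If some share in \<open>wins i x\<close> is at most \<open>c\<close>, then so is
    this one; hence the edge region contains \<open>wins (other i) x\<close> whenever it contains
    \<open>wins i x\<close>.\<close>
  have "share i (wins (other i) x) \<le> share (other i) (wins i x)"
    using le by (simp add: share_def divide_right_mono)
  then have "share i (wins (other i) x) \<le> share j (wins i x)" for j
    using share_wins_mono(3)[OF x, of i] eq_other_iff[of j i] by (cases "j = i") auto
  then show "settled_bound c d (wins (other i) x) \<le> settled_bound c d (wins i x)"
    by (auto simp: settled_bound_def intro: order_trans)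
qed

lemma sum_settled_bound_le:
  assumes "0 < c" and "c \<le> 1 / 2" and "0 < d"
  shows "(\<Sum>a\<le>j. settled_bound c d (reputations (Suc a) (Suc (j - a)))) \<le>
    real (j + 1) * (2 / d ^ 3 / real (j + 2)) + (real (j + 2) * (1 - 2 * c) + 1)"
proof -
  \<comment> \<open>For \<open>a\<close> up to \<open>j\<close>, these are the states in which both
    shares are at least \<open>c\<close>.\<close>
  let ?S = "{a. c * real (j + 2) - 1 \<le> real a \<and> real a \<le> real (j + 1) - c * real (j + 2)}"
  have S: "- 1 < c * real (j + 2) - 1" using assms by simp
  have "(\<Sum>a\<le>j. settled_bound c d (reputations (Suc a) (Suc (j - a)))) \<le>
    (\<Sum>a\<le>j. 2 / d ^ 3 / real (j + 2) + (if a \<in> ?S then 1 else 0))"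
  proof (rule sum_mono)
    fix a assume a: "a \<in> {..j}"
    then have n: "rep_sum (reputations (Suc a) (Suc (j - a))) = j + 2"
      by (simp add: rep_sum_def reputations_def)
    have s: "share Player1 (reputations (Suc a) (Suc (j - a))) = (real a + 1) / real (j + 2)"
      "share Player2 (reputations (Suc a) (Suc (j - a))) = (real j - real a + 1) / real (j + 2)"
      using a by (simp_all add: share_reputations of_nat_diff add_ac)
    have "0 \<le> 2 / d ^ 3 / real (j + 2)" using assms by simp
    moreover have "a \<in> ?S" if "c < share Player1 (reputations (Suc a) (Suc (j - a)))"
      "c < share Player2 (reputations (Suc a) (Suc (j - a)))"
      using that unfolding s by (simp add: less_divide_eq)
    ultimately show "settled_bound c d (reputations (Suc a) (Suc (j - a))) \<le>
        2 / d ^ 3 / real (j + 2) + (if a \<in> ?S then 1 else 0)"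
      unfolding settled_bound_def n by (auto simp: not_le)
  qed
  also have "\<dots> = real (j + 1) * (2 / d ^ 3 / real (j + 2)) + card ({..j} \<inter> ?S)"
    unfolding sum.distrib by (simp add: sum.If_cases del: mem_Collect_eq)
  also have "card ({..j} \<inter> ?S) \<le> card ?S"
    by (rule card_mono[OF card_nat_interval(1)[OF S]]) auto
  also have "real (card ?S) \<le> (real (j + 1) - c * real (j + 2)) - (c * real (j + 2) - 1) + 1"
  proof (rule card_nat_interval(3)[OF S])
    define R where "R = real (j + 2)"
    have R: "real (j + 1) = R - 1" by (simp add: R_def)
    have "c * R \<le> 1 / 2 * R" using assms by (intro mult_right_mono) (auto simp: R_def)
    then show "c * real (j + 2) - 1 \<le> real (j + 1) - c * real (j + 2) + 1"
      unfolding R_def[symmetric] R by linarith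
  qed
  finally show ?thesis by (simp add: algebra_simps)
qed

text \<open>Used with \<open>c = q + d\<close>: both shares are then at most
  \<open>1 - q - d\<close>, so each potential in \<open>contests_lower\<close> is just
  \<open>1 / rep_sum x\<close>.\<close>

definition contested_bound :: "real \<Rightarrow> real \<Rightarrow> reputation \<Rightarrow> real" where
  "contested_bound c d x = (if \<forall>i. c \<le> share i x then 1 - 2 / d\<^sup>2 / rep_sum x else 0)"

lemma sum_contested_bound_ge:
  assumes "0 < c" and "0 < d"
  shows "real (j + 2) * (1 - 2 * c) - 1 - real (j + 1) * (2 / d\<^sup>2 / real (j + 2)) \<le>
    (\<Sum>a\<le>j. contested_bound c d (reputations (Suc a) (Suc (j - a))))"
proof -
  let ?S = "{a. c * real (j + 2) - 1 \<le> real a \<and> real a \<le> real (j + 1) - c * real (j + 2)}"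
  have c: "0 < c * real (j + 2)" using assms by simp
  then have S: "- 1 < c * real (j + 2) - 1" by simp
  have sub: "?S \<subseteq> {..j}"
  proof
    fix a assume "a \<in> ?S"
    then have "real a < real (j + 1)" using c by auto
    then show "a \<in> {..j}" by simp
  qed
  have "real (j + 2) * (1 - 2 * c) - 1 \<le> real (card ?S)"
    using card_nat_interval(2)[OF S, of "real (j + 1) - c * real (j + 2)"] by (simp add: algebra_simps)
  then have "real (j + 2) * (1 - 2 * c) - 1 - real (j + 1) * (2 / d\<^sup>2 / real (j + 2)) \<le>
     (\<Sum>a\<le>j. (if a \<in> ?S then 1 else 0) - 2 / d\<^sup>2 / real (j + 2))"
    using sub unfolding sum_subtractf by (simp add: sum.If_cases Int_absorb1 del: mem_Collect_eq)
  also have "\<dots> \<le> (\<Sum>a\<le>j. contested_bound c d (reputations (Suc a) (Suc (j - a))))"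
  proof (rule sum_mono)
    fix a assume a: "a \<in> {..j}"
    then have n: "rep_sum (reputations (Suc a) (Suc (j - a))) = j + 2"
      by (simp add: rep_sum_def reputations_def)
    have s: "share Player1 (reputations (Suc a) (Suc (j - a))) = (real a + 1) / real (j + 2)"
      "share Player2 (reputations (Suc a) (Suc (j - a))) = (real j - real a + 1) / real (j + 2)"
      using a by (simp_all add: share_reputations of_nat_diff add_ac)
    have "0 \<le> 2 / d\<^sup>2 / real (j + 2)" using assms by simp
    moreover have "\<forall>i. c \<le> share i (reputations (Suc a) (Suc (j - a)))" if "a \<in> ?S"
      using that unfolding all_player s by (simp add: le_divide_eq)
    ultimately show "(if a \<in> ?S then 1 else 0) - 2 / d\<^sup>2 / real (j + 2) \<le>
        contested_bound c d (reputations (Suc a) (Suc (j - a)))"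
      unfolding contested_bound_def n by (simp del: mem_Collect_eq)
  qed
  finally show ?thesis .
qed

section \<open>The limiting proportion of contested rounds\<close>

lemma all_pos_start: "all_pos (reputations 1 1)"
  by (simp add: all_pos_def all_player reputations_def)

text \<open>First \<open>j\<close> is chosen so large that the uniform average of
  \<open>settled_bound\<close> is below \<open>b\<close>; then \<open>k\<close> grows and the
  \<open>j\<close> early rounds lose their weight.\<close>

lemma eventually_contests_less:
  assumes "0 < q" and "q < 1" and "1 - 2 * min q (1 / 2) < b"
  shows "\<forall>\<^sub>F k in sequentially. contests q k (reputations 1 1) / real k < b"
proof -
  define r where "r = min q (1 / 2)"
  \<comment> \<open>The first bound keeps \<open>c\<close> positive. The second makes
    \<open>4 * d\<close> at most half the gap, so that \<open>1 - 2 * c = 1 - 2 * r + 4 * d\<close>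
    stays below \<open>b\<close>.\<close>
  define d where "d = min (r / 4) ((b - (1 - 2 * r)) / 8)"
  define c where "c = r - 2 * d"
  have r: "0 < r" "r \<le> q" "r \<le> 1 / 2" using assms by (auto simp: r_def)
  have d: "0 < d" "d \<le> r / 4" "d \<le> (b - (1 - 2 * r)) / 8"
    unfolding d_def using assms r by (auto simp: r_def[symmetric] simp del: le_divide_eq_numeral1)
  have c: "0 < c" "c \<le> 1 / 2" "1 - 2 * c < b" "c + 2 * d \<le> q" "c + d \<le> 1 / 2"
    using d r by (auto simp: c_def field_simps)
  let ?B = "\<lambda>j. 2 / d ^ 3 / real (j + 2) + (real (j + 2) * (1 - 2 * c) + 1) / real (j + 1)"
  have "?B \<longlonglongrightarrow> 1 - 2 * c" using c d by real_asymp
  then have "\<forall>\<^sub>F j in sequentially. ?B j < b" using c by (intro order_tendstoD) auto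
  then obtain j where j: "?B j < b" by (auto simp: eventually_sequentially)
  define g where "g = settled_bound c d"
  have g: "contests q k y \<le> real k * g y" if "all_pos y" for k y
  proof (cases "\<exists>i. share i y \<le> c")
    case True
    then have "contests q k y \<le> real k * (2 / d ^ 3 / rep_sum y)"
      using contests_upper[OF that, of d q c] assms r d c by auto
    then show ?thesis using True contests_le[OF that, of q k]
      by (auto simp: g_def settled_bound_def min_def)
  qed (use contests_le[OF that] in \<open>simp add: g_def settled_bound_def\<close>)
  have "0 \<le> g y" for y using d by (simp add: g_def settled_bound_def)
  then have up: "contests q k (reputations 1 1) \<le> real j + real k * (urn ^^ j) g (reputations 1 1)" for k
    using contests_le_urn_iterate[OF unimodal_settled_bound _ _ all_pos_start, of c d] g unfolding g_def by blast
  have "(urn ^^ j) g (reputations 1 1) \<le> (real (j + 1) * (2 / d ^ 3 / real (j + 2)) + (real (j + 2) * (1 - 2 * c) + 1)) / (j + 1)"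
    unfolding urn_iterate_uniform g_def using sum_settled_bound_le[OF c(1,2) d(1)] by (intro divide_right_mono) auto
  also have "\<dots> = ?B j" by (simp add: add_divide_eq_iff del: of_nat_add)
  finally have u: "(urn ^^ j) g (reputations 1 1) < b" using j by simp
  have "(\<lambda>k. real j / real k + (urn ^^ j) g (reputations 1 1)) \<longlonglongrightarrow> 0 + (urn ^^ j) g (reputations 1 1)"
    by (intro tendsto_intros lim_const_over_n)
  then have "\<forall>\<^sub>F k in sequentially. real j / real k + (urn ^^ j) g (reputations 1 1) < b"
    using u by (intro order_tendstoD) auto
  with eventually_gt_at_top[of 0] show ?thesis
  proof eventually_elim
    case (elim k)
    have "contests q k (reputations 1 1) / real k \<le> (real j + real k * (urn ^^ j) g (reputations 1 1)) / real k"
      by (intro divide_right_mono up) auto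
    also have "\<dots> = real j / real k + (urn ^^ j) g (reputations 1 1)"
      using elim by (simp add: field_simps)
    finally show ?case using elim by simp
  qed
qed

lemma eventually_contests_greater:
  assumes "0 < q" and "b < 1 - 2 * min q (1 / 2)"
  shows "\<forall>\<^sub>F k in sequentially. b < contests q k (reputations 1 1) / real k"
proof (cases "q < 1 / 2")
  case False
  \<comment> \<open>Here the claimed limit is 0, and the proportion of contests is never
    negative.\<close>
  then have "b < 0" using assms by simp
  then have "b < contests q k (reputations 1 1) / real k" for k
    using contests_nonneg[of q k] by (intro order.strict_trans2[OF _ divide_nonneg_nonneg]) auto
  then show ?thesis by simp
next
  case True
  \<comment> \<open>With this \<open>d\<close>, the limit \<open>1 - 2 * c\<close> equals
    \<open>b + 2 * d\<close>.\<close>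
  define d where "d = (1 - 2 * q - b) / 4"
  define c where "c = q + d"
  have d: "0 < d" and c: "0 < c" "b < 1 - 2 * c"
    using assms True by (auto simp: d_def c_def field_simps)
  let ?B = "\<lambda>j. (real (j + 2) * (1 - 2 * c) - 1) / real (j + 1) - 2 / d\<^sup>2 / real (j + 2)"
  have "?B \<longlonglongrightarrow> 1 - 2 * c" using c d by real_asymp
  then have "\<forall>\<^sub>F j in sequentially. b < ?B j" using c by (intro order_tendstoD) auto
  then obtain j where j: "b < ?B j" by (auto simp: eventually_sequentially)
  define g where "g = contested_bound c d"
  have g: "real k * g y \<le> contests q k y" if "all_pos y" for k y
  proof (cases "\<forall>i. c \<le> share i y")
    case T: True
    have "share i y \<le> 1 - q - d" for i
      using T share_other[OF that, of i] by (metis c_def add.commute diff_diff_eq2 diff_le_eq le_diff_eq diff_diff_add)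
    then have "pot i (1 - q - d) y = 1 / rep_sum y" for i by (simp add: pot_def)
    then show ?thesis
      using contests_lower[of q y d k] T assms True d that by (simp add: g_def contested_bound_def field_simps)
  qed (use contests_nonneg in \<open>auto simp: g_def contested_bound_def\<close>)
  define u where "u = (urn ^^ j) g (reputations 1 1)"
  have "?B j = (real (j + 2) * (1 - 2 * c) - 1 - real (j + 1) * (2 / d\<^sup>2 / real (j + 2))) / (j + 1)"
    by (simp only: diff_divide_distrib nonzero_mult_div_cancel_left of_nat_eq_0_iff)
  also have "\<dots> \<le> u"
    unfolding u_def urn_iterate_uniform g_def using sum_contested_bound_ge[OF c(1) d(1)] by (intro divide_right_mono) auto
  finally have u: "b < u" using j by simp
  have "(\<lambda>k. (1 - real j / real k) * u) \<longlonglongrightarrow> (1 - 0) * u"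
    by (intro tendsto_intros lim_const_over_n)
  then have "\<forall>\<^sub>F k in sequentially. b < (1 - real j / real k) * u"
    using u by (intro order_tendstoD) auto
  moreover have "\<forall>\<^sub>F k in sequentially. (real k - real j) * u \<le> contests q k (reputations 1 1)"
    unfolding u_def by (rule eventually_contests_ge_urn_iterate[OF assms(1) True g all_pos_start])
  ultimately show ?thesis
    using eventually_gt_at_top[of 0]
  proof eventually_elim
    case (elim k)
    have "(1 - real j / real k) * u = ((real k - real j) * u) / real k"
      using elim by (simp add: field_simps)
    also have "\<dots> \<le> contests q k (reputations 1 1) / real k"
      using elim by (intro divide_right_mono) auto
    finally show ?case using elim by simp
  qed
qed

theorem corollary4p7:
  fixes q r :: real
  assumes "0 < q" and "q < 1"
    and "r = min q (1 / 2)"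
  shows "(\<lambda>k. performance_ratio q k 1 1) \<longlonglongrightarrow> (1 + 2 * r * q) / (1 + q)"
proof -
  have "(\<lambda>k. contests q k (reputations 1 1) / real k) \<longlonglongrightarrow> 1 - 2 * r"
    unfolding assms(3)
    by (intro order_tendstoI eventually_contests_less eventually_contests_greater assms)
  then have "(\<lambda>k. 1 - q / (1 + q) * (contests q k (reputations 1 1) / real k)) \<longlonglongrightarrow>
      1 - q / (1 + q) * (1 - 2 * r)"
    by (intro tendsto_intros)
  also have "1 - q / (1 + q) * (1 - 2 * r) = (1 + 2 * r * q) / (1 + q)"
    using assms by (simp add: field_simps)
  finally show ?thesis
  proof (rule Lim_transform_eventually)
    \<comment> \<open>By the welfare formula the ratio is affine in the proportion of contested
      rounds; the division by \<open>k\<close> requires \<open>k > 0\<close>.\<close>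
    show "\<forall>\<^sub>F k in sequentially. 1 - q / (1 + q) * (contests q k (reputations 1 1) / real k) =
        performance_ratio q k 1 1"
      using eventually_gt_at_top[of 0]
    proof eventually_elim
      case (elim k)
      have "social_welfare q k (reputations 1 1) (canonical q k (reputations 1 1)) =
          real k * (1 + q) - q * contests q k (reputations 1 1)"
        using welfare_contests[OF all_pos_start] by (simp add: social_welfare_def val_def)
      then have "performance_ratio q k 1 1 =
          (real k * (1 + q) - q * contests q k (reputations 1 1)) / (real k * (1 + q))"
        by (simp only: performance_ratio_def)
      also have "\<dots> = 1 - q / (1 + q) * (contests q k (reputations 1 1) / real k)"
        using elim assms by (simp add: diff_divide_distrib mult.commute)
      finally show ?case by (rule sym)
    qed
  qed
qed

end
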